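(* Let $X$ be a nonempty Tychonoff space, and $G$ be a topological group containing an arc. Then $\chi(\mathrm{C}(X,G))=\mathrm{cof}(\mathrm{K}(X))\cdot\chi(G)$.
   Context: $\mathrm{C}(X,G)$ is the group of continuous functions from $X$ to $G$ with pointwise operations, equipped with the compact-open topology. An arc is a subspace homeomorphic to the unit interval $[0,1]$. The character $\chi(H)$ of a topological group $H$ is the minimal cardinality of a local base at the identity of $H$. $\mathrm{K}(X)$ is the family of compact subsets of $X$, partially ordered by inclusion. For a partially ordered set $P$, $\mathrm{cof}(P)$ is the minimal cardinality of a cofinal subset of $P$ (a subset $C$ such that each $p\in P$ satisfies $p\le c$ for some $c\in C$). *)

theory Defs
  imports "HOL-Analysis.Analysis" "HOL-Algebra.Group"
begin

unbundle cardinal_syntax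

text \<open>Cardinals are represented by well-orders of minimal order type and compared up to
  \<open>=o\<close>, so the least cardinality of a member of \<open>\<F>\<close> is a representative chosen with \<open>SOME\<close>.
  It is only meaningful for nonempty \<open>\<F>\<close>.\<close>

definition min_card :: "'a set set \<Rightarrow> 'a rel" where
  "min_card \<F> = (SOME r. \<exists>A\<in>\<F>. r = |A| \<and> (\<forall>B\<in>\<F>. |A| \<le>o |B| ))"

lemma min_card:
  assumes "\<F> \<noteq> {}"
  shows "\<exists>A\<in>\<F>. min_card \<F> = |A| \<and> (\<forall>B\<in>\<F>. |A| \<le>o |B| )"
proof -
  have "\<exists>r\<in>card_of ` \<F>. \<forall>r'\<in>card_of ` \<F>. r \<le>o r'"
    using assms by (intro exists_minim_Card_order) (auto intro: card_of_Card_order)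
  then have "\<exists>r. \<exists>A\<in>\<F>. r = |A| \<and> (\<forall>B\<in>\<F>. |A| \<le>o |B| )"
    by auto
  then show ?thesis
    unfolding min_card_def by (rule someI_ex)
qed

definition cof :: "'a set \<Rightarrow> ('a \<Rightarrow> 'a \<Rightarrow> bool) \<Rightarrow> 'a rel" where
  "cof P leq = min_card {C. C \<subseteq> P \<and> (\<forall>p\<in>P. \<exists>c\<in>C. leq p c)}"

definition local_base_at :: "'a topology \<Rightarrow> 'a \<Rightarrow> 'a set set \<Rightarrow> bool" where
  "local_base_at T x \<B> \<longleftrightarrow>
     (\<forall>U\<in>\<B>. openin T U \<and> x \<in> U) \<and> (\<forall>W. openin T W \<and> x \<in> W \<longrightarrow> (\<exists>U\<in>\<B>. U \<subseteq> W))"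

text \<open>No separation axiom is imposed on topological groups.\<close>

locale topological_group = group G for G (structure) +
  fixes T :: "'a topology"
  assumes topspace_eq_carrier: "topspace T = carrier G"
    and continuous_mult: "continuous_map (prod_topology T T) T (\<lambda>(x, y). x \<otimes> y)"
    and continuous_inv: "continuous_map T T (\<lambda>x. inv x)"

definition character :: "('g, 'm) monoid_scheme \<Rightarrow> 'g topology \<Rightarrow> 'g set rel" where
  "character G T = min_card {\<B>. local_base_at T \<one>\<^bsub>G\<^esub> \<B>}"

definition compact_sets :: "'a topology \<Rightarrow> 'a set set" where
  "compact_sets X = {K. compactin X K}"

text \<open>A continuous function on \<open>X\<close> is represented by its extension with value \<open>undefined\<close>
  outside \<open>topspace X\<close>, so that distinct elements are distinct functions on \<open>X\<close>.\<close>

definition cont_maps :: "'a topology \<Rightarrow> 'b topology \<Rightarrow> ('a \<Rightarrow> 'b) set" where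
  "cont_maps X Y = {f \<in> extensional (topspace X). continuous_map X Y f}"

definition compact_open_topology :: "'a topology \<Rightarrow> 'b topology \<Rightarrow> ('a \<Rightarrow> 'b) topology" where
  "compact_open_topology X Y =
     topology_generated_by {{f \<in> cont_maps X Y. f ` K \<subseteq> U} | K U. K \<in> compact_sets X \<and> openin Y U}"

lemma topspace_compact_open_topology: "topspace (compact_open_topology X Y) = cont_maps X Y"
proof -
  have "{f \<in> cont_maps X Y. f ` {} \<subseteq> {}}
          \<in> {{f \<in> cont_maps X Y. f ` K \<subseteq> U} | K U. K \<in> compact_sets X \<and> openin Y U}"
    unfolding compact_sets_def by blast
  then show ?thesis
    unfolding compact_open_topology_def topology_generated_by_topspace by auto
qed

definition cont_group ::
    "'a topology \<Rightarrow> ('g, 'm) monoid_scheme \<Rightarrow> 'g topology \<Rightarrow> ('a \<Rightarrow> 'g) monoid" where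
  "cont_group X G T =
     \<lparr>carrier = cont_maps X T,
      mult = (\<lambda>f g. \<lambda>x\<in>topspace X. f x \<otimes>\<^bsub>G\<^esub> g x),
      one = (\<lambda>x\<in>topspace X. \<one>\<^bsub>G\<^esub>)\<rparr>"

lemma (in topological_group) group_cont_group: "group (cont_group X G T)"
proof (rule groupI)
  let ?C = "cont_group X G T"
  have in_carrier: "f x \<in> carrier G" if "f \<in> carrier ?C" "x \<in> topspace X" for f x
    using that continuous_map_funspace[of X T f] topspace_eq_carrier
    by (auto simp: cont_group_def cont_maps_def)
  have cont_restrict: "continuous_map X T (restrict f (topspace X)) \<longleftrightarrow> continuous_map X T f" for f
    by (intro iffI; erule continuous_map_eq) auto
  show "\<one>\<^bsub>?C\<^esub> \<in> carrier ?C"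
    by (simp add: cont_group_def cont_maps_def cont_restrict topspace_eq_carrier)
  fix f assume f: "f \<in> carrier ?C"
  have "continuous_map X T ((\<lambda>x. inv x) \<circ> f)"
    using f by (intro continuous_map_compose[OF _ continuous_inv])
      (simp add: cont_group_def cont_maps_def)
  then have "(\<lambda>x\<in>topspace X. inv (f x)) \<in> carrier ?C"
    by (simp add: cont_group_def cont_maps_def cont_restrict o_def)
  moreover have "(\<lambda>x\<in>topspace X. inv (f x)) \<otimes>\<^bsub>?C\<^esub> f = \<one>\<^bsub>?C\<^esub>"
    using in_carrier[OF f] by (auto simp: cont_group_def fun_eq_iff)
  ultimately show "\<exists>g\<in>carrier ?C. g \<otimes>\<^bsub>?C\<^esub> f = \<one>\<^bsub>?C\<^esub>"
    by blast
  show "\<one>\<^bsub>?C\<^esub> \<otimes>\<^bsub>?C\<^esub> f = f"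
  proof
    fix x
    show "(\<one>\<^bsub>?C\<^esub> \<otimes>\<^bsub>?C\<^esub> f) x = f x"
      using f in_carrier[OF f, of x]
      by (cases "x \<in> topspace X") (auto simp: cont_group_def cont_maps_def extensional_def)
  qed
  fix g assume g: "g \<in> carrier ?C"
  have "continuous_map X T ((\<lambda>(x, y). x \<otimes> y) \<circ> (\<lambda>x. (f x, g x)))"
    using f g by (intro continuous_map_compose[OF _ continuous_mult])
      (simp add: cont_group_def cont_maps_def continuous_map_pairedI)
  then show "f \<otimes>\<^bsub>?C\<^esub> g \<in> carrier ?C"
    by (simp add: cont_group_def cont_maps_def cont_restrict o_def)
  fix h assume h: "h \<in> carrier ?C"
  show "f \<otimes>\<^bsub>?C\<^esub> g \<otimes>\<^bsub>?C\<^esub> h = f \<otimes>\<^bsub>?C\<^esub> (g \<otimes>\<^bsub>?C\<^esub> h)"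
    using in_carrier[OF f] in_carrier[OF g] in_carrier[OF h]
    by (auto simp: cont_group_def fun_eq_iff m_assoc)
qed

definition contains_arc :: "'a topology \<Rightarrow> bool" where
  "contains_arc T \<longleftrightarrow>
     (\<exists>A \<subseteq> topspace T. subtopology T A homeomorphic_space top_of_set {0..1::real})"

end

theory Submission
  imports Defs
begin

text \<open>Write \<open>[K, U]\<close> for the set of continuous \<open>f\<close> with \<open>f ` K \<subseteq> U\<close>, where \<open>K\<close> is compact and
  \<open>U\<close> is open. The sets \<open>[K, U]\<close> with \<open>\<one> \<in> U\<close> form a local base at the identity of the function
  group, because \<open>[K \<union> K', U \<inter> U'] \<subseteq> [K, U] \<inter> [K', U']\<close>
  (\<open>compact_open_nhd_const\<close>). It is enough to let \<open>K\<close> run through a cofinal family of compact sets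
  and \<open>U\<close> through a local base of \<open>G\<close>, which gives the inequality \<open>\<le>\<close>.

  For the converse, the character of the function group is at least that of \<open>G\<close>, since \<open>G\<close>
  embeds in it as the subgroup of constant maps (\<open>character_le_const\<close>). It is also at least the
  cofinality: given a local base, choose some \<open>[K\<^sub>V, U\<^sub>V]\<close> inside each member \<open>V\<close>. The sets
  \<open>K\<^sub>V\<close> are cofinal (\<open>cof_compact_le\<close>), since for a point \<open>x\<close> outside \<open>K\<^sub>V\<close> complete regularity
  provides a function \<open>X \<rightarrow> [0, 1]\<close> separating \<open>x\<close> from \<open>K\<^sub>V\<close>; followed by an arc that is
  translated so as to end at \<open>\<one>\<close>, it is \<open>\<one>\<close> on \<open>K\<^sub>V\<close> and leaves a fixed neighbourhood of \<open>\<one>\<close> at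
  \<open>x\<close>.

  The two lower bounds combine to a bound on the product because the character of \<open>G\<close> is infinite:
  a finite local base would give a smallest neighbourhood of \<open>\<one>\<close>, and the points of the arc near
  \<open>\<one>\<close> would lie in it, although each of them is missed by some neighbourhood of \<open>\<one>\<close>
  (\<open>local_base_infinite\<close>).\<close>

section \<open>Least cardinalities\<close>

lemma min_card_le:
  assumes "B \<in> \<F>"
  shows "min_card \<F> \<le>o |B|"
proof -
  have "\<F> \<noteq> {}" using assms by blast
  from min_card[OF this] show ?thesis using assms by auto
qed

lemma min_card_attained:
  assumes "\<F> \<noteq> {}"
  obtains A where "A \<in> \<F>" "min_card \<F> = |A|"
  using min_card[OF assms] by (elim bexE conjE) (rule that)

lemma local_base_attaining_min_card:
  obtains \<B> where "local_base_at T x \<B>" "min_card {\<B>. local_base_at T x \<B>} = |\<B>|"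
proof -
  have "local_base_at T x {U. openin T U \<and> x \<in> U}"
    by (auto simp: local_base_at_def)
  then show ?thesis
    by (metis (mono_tags) min_card_attained[of "{\<B>. local_base_at T x \<B>}"] that
        empty_iff mem_Collect_eq)
qed

lemma cofinal_compact_attaining_cof:
  obtains C where "C \<subseteq> compact_sets X" "\<forall>K\<in>compact_sets X. \<exists>L\<in>C. K \<subseteq> L"
    "cof (compact_sets X) (\<subseteq>) = |C|"
proof -
  define F where "F = {C. C \<subseteq> compact_sets X \<and> (\<forall>p\<in>compact_sets X. \<exists>c\<in>C. p \<subseteq> c)}"
  have "compact_sets X \<in> F" by (auto simp: F_def)
  then have "F \<noteq> {}" by blast
  then obtain C where C: "C \<in> F" "min_card F = |C|"
    by (rule min_card_attained)
  show ?thesis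
  proof (rule that)
    show "C \<subseteq> compact_sets X" "\<forall>K\<in>compact_sets X. \<exists>L\<in>C. K \<subseteq> L"
      using C(1) by (simp_all add: F_def)
    show "cof (compact_sets X) (\<subseteq>) = |C|"
      using C(2) by (simp add: cof_def F_def)
  qed
qed

section \<open>Neighbourhoods of constant maps in the compact-open topology\<close>

definition maps_into :: "'a topology \<Rightarrow> 'b topology \<Rightarrow> 'a set \<Rightarrow> 'b set \<Rightarrow> ('a \<Rightarrow> 'b) set" where
  "maps_into X Y K U = {f \<in> cont_maps X Y. f ` K \<subseteq> U}"

lemma openin_maps_into:
  assumes "compactin X K" "openin Y U"
  shows "openin (compact_open_topology X Y) (maps_into X Y K U)"
  unfolding compact_open_topology_def openin_topology_generated_by_iff
  using assms
  by (intro generate_topology_on.Basis) (unfold maps_into_def compact_sets_def, blast)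

lemma restrict_in_cont_maps:
  assumes "continuous_map X Y f"
  shows "restrict f (topspace X) \<in> cont_maps X Y"
proof -
  have "continuous_map X Y (restrict f (topspace X))"
    by (rule continuous_map_eq[OF assms]) simp
  then show ?thesis by (simp add: cont_maps_def)
qed

lemma const_in_maps_into:
  assumes "compactin X K" "openin Y U" "c \<in> U"
  shows "(\<lambda>x\<in>topspace X. c) \<in> maps_into X Y K U"
proof -
  have "continuous_map X Y (\<lambda>x. c)"
    using assms openin_subset by (auto simp: continuous_map_const)
  moreover have "K \<subseteq> topspace X"
    using assms by (simp add: compactin_subset_topspace)
  ultimately show ?thesis
    using assms restrict_in_cont_maps[of X Y "\<lambda>x. c"] by (auto simp: maps_into_def)
qed

text \<open>At a general map, finite intersections of the sets \<^const>\<open>maps_into\<close> are needed; at a constant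
  map a single one is enough, since all the open sets involved contain the same point \<open>c\<close>.\<close>

lemma compact_open_nhd_const:
  assumes "openin (compact_open_topology X Y) W" "(\<lambda>x\<in>topspace X. c) \<in> W" "c \<in> topspace Y"
  obtains K U where "compactin X K" "openin Y U" "c \<in> U" "maps_into X Y K U \<subseteq> W"
proof -
  let ?S = "{{f \<in> cont_maps X Y. f ` K \<subseteq> U} | K U. K \<in> compact_sets X \<and> openin Y U}"
  have "generate_topology_on ?S W"
    using assms(1) by (simp add: compact_open_topology_def openin_topology_generated_by_iff)
  then have "\<exists>K U. compactin X K \<and> openin Y U \<and> c \<in> U \<and> maps_into X Y K U \<subseteq> W"
    using assms(2)
  proof induction
    case Empty
    then show ?case by simp
  next
    case (Int V V')
    then obtain K U K' U' where
      "compactin X K" "openin Y U" "c \<in> U" "maps_into X Y K U \<subseteq> V"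
      "compactin X K'" "openin Y U'" "c \<in> U'" "maps_into X Y K' U' \<subseteq> V'"
      by blast
    moreover have "maps_into X Y (K \<union> K') (U \<inter> U') \<subseteq> maps_into X Y K U \<inter> maps_into X Y K' U'"
      by (auto simp: maps_into_def)
    ultimately show ?case
      by (intro exI[of _ "K \<union> K'"] exI[of _ "U \<inter> U'"]) (auto simp: compactin_Un)
  next
    case (UN \<V>)
    then obtain V where V: "V \<in> \<V>" "(\<lambda>x\<in>topspace X. c) \<in> V"
      by blast
    from UN.IH[OF this] obtain K U where
      "compactin X K" "openin Y U" "c \<in> U" "maps_into X Y K U \<subseteq> V"
      by blast
    with V(1) show ?case
      by (meson Union_upper order_trans)
  next
    case (Basis V)
    then obtain K U where KU: "V = maps_into X Y K U" "compactin X K" "openin Y U"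
      by (auto simp: maps_into_def compact_sets_def)
    show ?case
    proof (cases "K = {}")
      \<comment> \<open>Membership in \<open>V\<close> then says nothing about \<open>c\<close>, and \<open>U\<close> has to be enlarged.\<close>
      case True
      then have "maps_into X Y {} (topspace Y) \<subseteq> V"
        using KU by (auto simp: maps_into_def)
      then show ?thesis
        using assms(3) by (metis compactin_empty openin_topspace)
    next
      case False
      then obtain x where "x \<in> K" by blast
      then have "x \<in> topspace X"
        using KU by (meson compactin_subset_topspace subsetD)
      then have "c \<in> U"
        using Basis(2) KU \<open>x \<in> K\<close> by (force simp: maps_into_def)
      then show ?thesis using KU by blast
    qed
  qed
  then show ?thesis using that by blast
qed

lemma local_base_maps_into:
  assumes base: "local_base_at Y c \<B>" and c: "c \<in> topspace Y"
    and C: "C \<subseteq> compact_sets X" "\<forall>K\<in>compact_sets X. \<exists>L\<in>C. K \<subseteq> L"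
  shows "local_base_at (compact_open_topology X Y) (\<lambda>x\<in>topspace X. c)
           ((\<lambda>(K, U). maps_into X Y K U) ` (C \<times> \<B>))"
  unfolding local_base_at_def
proof (intro conjI ballI allI impI)
  fix V assume "V \<in> (\<lambda>(K, U). maps_into X Y K U) ` (C \<times> \<B>)"
  then obtain K U where V: "V = maps_into X Y K U" "compactin X K" "openin Y U" "c \<in> U"
    using base C(1) by (auto simp: local_base_at_def compact_sets_def)
  then show "openin (compact_open_topology X Y) V" "(\<lambda>x\<in>topspace X. c) \<in> V"
    using openin_maps_into const_in_maps_into by metis+
next
  fix W
  assume "openin (compact_open_topology X Y) W \<and> (\<lambda>x\<in>topspace X. c) \<in> W"
  then obtain K U where KU: "compactin X K" "openin Y U" "c \<in> U" "maps_into X Y K U \<subseteq> W"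
    using c compact_open_nhd_const by metis
  obtain L where L: "L \<in> C" "K \<subseteq> L"
    using C(2) KU(1) by (auto simp: compact_sets_def)
  obtain U' where U': "U' \<in> \<B>" "U' \<subseteq> U"
    using base KU by (auto simp: local_base_at_def)
  have "maps_into X Y L U' \<subseteq> maps_into X Y K U"
    using L U' by (auto simp: maps_into_def)
  then have "maps_into X Y L U' \<subseteq> W"
    using KU(4) by blast
  then show "\<exists>V\<in>(\<lambda>(K, U). maps_into X Y K U) ` (C \<times> \<B>). V \<subseteq> W"
    using L U' by force
qed

section \<open>Bounds on local bases at a constant map\<close>

lemma continuous_map_const_into_compact_open:
  "continuous_map Y (compact_open_topology X Y) (\<lambda>c. \<lambda>x\<in>topspace X. c)"
  unfolding compact_open_topology_def
proof (rule continuous_on_generated_topo)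
  let ?S = "{{f \<in> cont_maps X Y. f ` K \<subseteq> U} | K U. K \<in> compact_sets X \<and> openin Y U}"
  have const: "(\<lambda>x\<in>topspace X. c) \<in> cont_maps X Y" if "c \<in> topspace Y" for c
    using that by (intro restrict_in_cont_maps) (simp add: continuous_map_const)
  fix V assume "V \<in> ?S"
  then obtain K U where V: "V = {f \<in> cont_maps X Y. f ` K \<subseteq> U}"
    and K: "K \<subseteq> topspace X" and U: "openin Y U"
    by (auto simp: compact_sets_def compactin_subset_topspace)
  have "(\<lambda>c. \<lambda>x\<in>topspace X. c) -` V \<inter> topspace Y = (if K = {} then topspace Y else U)"
    using const K openin_subset[OF U] unfolding V by (auto simp: image_subset_iff)
  then show "openin Y ((\<lambda>c. \<lambda>x\<in>topspace X. c) -` V \<inter> topspace Y)"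
    using U by auto
next
  show "(\<lambda>c. \<lambda>x\<in>topspace X. c) ` topspace Y
    \<subseteq> \<Union>{{f \<in> cont_maps X Y. f ` K \<subseteq> U} | K U. K \<in> compact_sets X \<and> openin Y U}"
    using topspace_compact_open_topology[of X Y]
    unfolding compact_open_topology_def topology_generated_by_topspace
    by (auto intro!: restrict_in_cont_maps simp: continuous_map_const)
qed

text \<open>The constant maps carry the topology of \<open>Y\<close>: evaluation at a point, which exists because
  \<open>X\<close> is nonempty, inverts the embedding. So local bases can be pulled back.\<close>

lemma character_le_const:
  assumes "topspace X \<noteq> {}" "c \<in> topspace Y"
    and base: "local_base_at (compact_open_topology X Y) (\<lambda>x\<in>topspace X. c) \<V>"
  shows "min_card {\<B>. local_base_at Y c \<B>} \<le>o |\<V>|"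
proof -
  define pull where "pull V = {d \<in> topspace Y. (\<lambda>x\<in>topspace X. d) \<in> V}" for V
  have "local_base_at Y c (pull ` \<V>)"
    unfolding local_base_at_def
  proof (intro conjI ballI allI impI)
    fix U assume "U \<in> pull ` \<V>"
    then show "openin Y U" "c \<in> U"
      using base assms(2)
        openin_continuous_map_preimage[OF continuous_map_const_into_compact_open]
      by (auto simp: local_base_at_def pull_def)
  next
    fix W assume W: "openin Y W \<and> c \<in> W"
    obtain x where x: "x \<in> topspace X" using assms(1) by blast
    have "openin (compact_open_topology X Y) (maps_into X Y {x} W)"
      "(\<lambda>x\<in>topspace X. c) \<in> maps_into X Y {x} W"
      using x W by (auto intro!: openin_maps_into const_in_maps_into)
    then obtain V where V: "V \<in> \<V>" "V \<subseteq> maps_into X Y {x} W"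
      using base by (auto simp: local_base_at_def)
    then have "pull V \<subseteq> W"
      using x by (auto simp: pull_def maps_into_def)
    then show "\<exists>U\<in>pull ` \<V>. U \<subseteq> W" using V by blast
  qed
  then have "min_card {\<B>. local_base_at Y c \<B>} \<le>o |pull ` \<V>|"
    by (intro min_card_le) simp
  then show ?thesis
    using card_of_image ordLeq_transitive by blast
qed

text \<open>A map that is \<open>c\<close> on a
  compact set lies in every basic neighbourhood over that set, so complete regularity forces a basic
  neighbourhood contained in \<open>[K, U]\<close> to be taken over a superset of \<open>K\<close>.\<close>

lemma cof_compact_le:
  assumes X: "completely_regular_space X" "Hausdorff_space X"
    and p: "continuous_map (top_of_set {0..1::real}) Y p" "p 1 = c"
    and U: "openin Y U" "c \<in> U" "p 0 \<notin> U"
    and base: "local_base_at (compact_open_topology X Y) (\<lambda>x\<in>topspace X. c) \<V>"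
  shows "cof (compact_sets X) (\<subseteq>) \<le>o |\<V>|"
proof -
  have c: "c \<in> topspace Y" using U openin_subset by blast
  have "\<exists>K U'. compactin X K \<and> openin Y U' \<and> c \<in> U' \<and> maps_into X Y K U' \<subseteq> V"
    if "V \<in> \<V>" for V
    using that base c by (metis compact_open_nhd_const local_base_at_def)
  then obtain k u where ku: "\<And>V. V \<in> \<V> \<Longrightarrow> compactin X (k V) \<and> openin Y (u V) \<and> c \<in> u V \<and>
      maps_into X Y (k V) (u V) \<subseteq> V"
    by metis
  have "\<exists>L\<in>k ` \<V>. K \<subseteq> L" if K: "compactin X K" for K
  proof -
    have "openin (compact_open_topology X Y) (maps_into X Y K U)"
      "(\<lambda>x\<in>topspace X. c) \<in> maps_into X Y K U"
      using K U by (auto intro!: openin_maps_into const_in_maps_into)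
    then obtain V where V: "V \<in> \<V>" "V \<subseteq> maps_into X Y K U"
      using base by (auto simp: local_base_at_def)
    have "x \<in> k V" if x: "x \<in> K" for x
    proof (rule ccontr)
      assume "x \<notin> k V"
      moreover have "closedin X (k V)"
        using ku V X(2) compactin_imp_closedin by blast
      moreover have xX: "x \<in> topspace X"
        using K x by (meson compactin_subset_topspace subsetD)
      ultimately obtain \<phi> where \<phi>: "continuous_map X (top_of_set {0..1::real}) \<phi>"
        "\<phi> x = 0" "\<phi> ` k V \<subseteq> {1}"
        using X(1) unfolding completely_regular_space_def by blast
      have "k V \<subseteq> topspace X"
        using ku V by (simp add: compactin_subset_topspace)
      moreover have "continuous_map X Y (p \<circ> \<phi>)"
        using \<phi>(1) p(1) by (rule continuous_map_compose)
      ultimately have "restrict (p \<circ> \<phi>) (topspace X) \<in> maps_into X Y (k V) (u V)"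
        using \<phi>(3) p(2) ku[OF V(1)] restrict_in_cont_maps[of X Y "p \<circ> \<phi>"]
        by (auto simp: maps_into_def image_subset_iff)
      then have "restrict (p \<circ> \<phi>) (topspace X) \<in> maps_into X Y K U"
        using ku V by blast
      then have "p (\<phi> x) \<in> U"
        using x xX by (auto simp: maps_into_def)
      then show False using \<phi>(2) U(3) by simp
    qed
    then show ?thesis using V by blast
  qed
  then have "cof (compact_sets X) (\<subseteq>) \<le>o |k ` \<V>|"
    unfolding cof_def using ku by (intro min_card_le) (auto simp: compact_sets_def)
  then show ?thesis
    using card_of_image ordLeq_transitive by blast
qed

section \<open>Arcs in topological groups\<close>

lemma local_base_infinite:
  assumes p: "continuous_map (top_of_set {0..1::real}) Y p" "p 1 = c"
    and sep: "\<And>t. t \<in> {0..<1} \<Longrightarrow> \<exists>U. openin Y U \<and> c \<in> U \<and> p t \<notin> U"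
    and base: "local_base_at Y c \<B>"
  shows "infinite \<B>"
proof
  assume fin: "finite \<B>"
  have "c \<in> topspace Y"
    using continuous_map_funspace[OF p(1)] p(2) by (auto simp: Pi_iff)
  then have "\<B> \<noteq> {}"
    using base unfolding local_base_at_def by (metis empty_iff openin_topspace)
  define N where "N = \<Inter>\<B>"
  have N: "openin Y N" "c \<in> N"
    using fin \<open>\<B> \<noteq> {}\<close> base by (auto simp: N_def local_base_at_def intro: openin_Inter)
  have "openin (top_of_set {0..1::real}) {t \<in> {0..1}. p t \<in> N}"
    using openin_continuous_map_preimage[OF p(1) N(1)] by simp
  moreover have "1 \<in> {t \<in> {0..1::real}. p t \<in> N}"
    using N(2) p(2) by simp
  ultimately obtain e where e: "e > 0"
    "ball 1 e \<inter> {0..1::real} \<subseteq> {t \<in> {0..1}. p t \<in> N}"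
    by (meson openin_contains_ball)
  define t where "t = max 0 (1 - e / 2)"
  have t: "t \<in> {0..<1}" "t \<in> ball 1 e \<inter> {0..1}"
    using e(1) by (auto simp: t_def dist_real_def)
  then have "p t \<in> N" using e(2) by blast
  moreover obtain U where "openin Y U" "c \<in> U" "p t \<notin> U"
    using sep[OF t(1)] by blast
  moreover have "N \<subseteq> U"
    using base calculation unfolding N_def local_base_at_def by blast
  ultimately show False by blast
qed

text \<open>Since \<open>T\<close> need not be Hausdorff, an open set around \<open>\<one>\<close> that misses a given point of the arc
  has to be taken from the subspace topology of the arc itself.\<close>

lemma (in topological_group) arc_ending_at_one:
  assumes "contains_arc T"
  obtains p where "continuous_map (top_of_set {0..1::real}) T p" "p 1 = \<one>"
    "\<And>t. t \<in> {0..<1} \<Longrightarrow> \<exists>U. openin T U \<and> \<one> \<in> U \<and> p t \<notin> U"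
proof -
  obtain A where A: "A \<subseteq> topspace T"
    "top_of_set {0..1::real} homeomorphic_space subtopology T A"
    using assms unfolding contains_arc_def by (metis homeomorphic_space_sym)
  then obtain \<alpha> where \<alpha>: "homeomorphic_map (top_of_set {0..1::real}) (subtopology T A) \<alpha>"
    unfolding homeomorphic_space by blast
  have cont: "continuous_map (top_of_set {0..1::real}) T \<alpha>"
    using homeomorphic_imp_continuous_map[OF \<alpha>] by (simp add: continuous_map_in_subtopology)
  have \<alpha>A: "\<alpha> t \<in> A" if "t \<in> {0..1}" for t
    using homeomorphic_imp_surjective_map[OF \<alpha>] that A(1) by auto
  have carr: "\<alpha> t \<in> carrier G" if "t \<in> {0..1}" for t
    using \<alpha>A[OF that] A(1) topspace_eq_carrier by auto
  have translation: "continuous_map T T (\<lambda>g. a \<otimes> g)" if "a \<in> carrier G" for a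
  proof -
    have "continuous_map T (prod_topology T T) (\<lambda>g. (a, g))"
      using that by (intro continuous_map_pairedI) (simp_all add: continuous_map_const topspace_eq_carrier)
    then show ?thesis
      using continuous_map_compose[OF _ continuous_mult] by (force simp: o_def)
  qed
  define p where "p t = inv (\<alpha> 1) \<otimes> \<alpha> t" for t
  have "continuous_map (top_of_set {0..1::real}) T ((\<lambda>g. inv (\<alpha> 1) \<otimes> g) \<circ> \<alpha>)"
    using cont by (rule continuous_map_compose) (simp add: translation carr)
  then have "continuous_map (top_of_set {0..1::real}) T p"
    unfolding p_def o_def .
  moreover have "p 1 = \<one>"
    using carr by (simp add: p_def)
  moreover have "\<exists>U. openin T U \<and> \<one> \<in> U \<and> p t \<notin> U" if t: "t \<in> {0..<1}" for t
  proof -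
    have "Hausdorff_space (subtopology T A)"
      using homeomorphic_Hausdorff_space[OF A(2)] Hausdorff_space_euclidean
        Hausdorff_space_subtopology by blast
    moreover have "\<alpha> t \<noteq> \<alpha> 1"
      using homeomorphic_imp_injective_map[OF \<alpha>] t by (fastforce dest: inj_onD)
    moreover have "\<alpha> t \<in> topspace (subtopology T A)" "\<alpha> 1 \<in> topspace (subtopology T A)"
      using \<alpha>A t A(1) by auto
    ultimately obtain V V' where "openin (subtopology T A) V" "\<alpha> 1 \<in> V"
      "\<alpha> t \<in> V'" "disjnt V' V"
      unfolding Hausdorff_space_def by metis
    then obtain W where W: "openin T W" "\<alpha> 1 \<in> W" "\<alpha> t \<notin> W"
      using \<alpha>A[of t] t by (auto simp: openin_subtopology disjnt_iff)
    have "openin T {g \<in> topspace T. \<alpha> 1 \<otimes> g \<in> W}"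
      using translation[OF carr[of 1]] W(1) by (simp add: openin_continuous_map_preimage)
    moreover have "\<alpha> 1 \<otimes> p t = \<alpha> t"
      using carr t by (simp add: p_def m_assoc[symmetric])
    ultimately show ?thesis
      using W carr[of 1]
      by (intro exI[of _ "{g \<in> topspace T. \<alpha> 1 \<otimes> g \<in> W}"]) (auto simp: topspace_eq_carrier)
  qed
  ultimately show ?thesis using that by blast
qed

section \<open>The character of the function group\<close>

theorem proposition5p4:
  fixes X :: "'a topology" and G :: "('g, 'm) monoid_scheme" and T :: "'g topology"
  assumes "topspace X \<noteq> {}"
    and "completely_regular_space X" and "Hausdorff_space X"
    and "topological_group G T"
    and "contains_arc T"
  shows "character (cont_group X G T) (compact_open_topology X T)
           =o cof (compact_sets X) (\<subseteq>) *c character G T"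
proof -
  interpret topological_group G T by fact
  let ?CO = "compact_open_topology X T" and ?e = "\<lambda>x\<in>topspace X. \<one>\<^bsub>G\<^esub>"
  have one: "\<one>\<^bsub>G\<^esub> \<in> topspace T"
    by (simp add: topspace_eq_carrier)
  have char: "character (cont_group X G T) ?CO = min_card {\<V>. local_base_at ?CO ?e \<V>}"
    by (simp add: character_def cont_group_def)
  obtain \<V> where \<V>: "local_base_at ?CO ?e \<V>" "character (cont_group X G T) ?CO = |\<V>|"
    unfolding char by (rule local_base_attaining_min_card)
  obtain \<B> where \<B>: "local_base_at T \<one>\<^bsub>G\<^esub> \<B>" "character G T = |\<B>|"
    unfolding character_def by (rule local_base_attaining_min_card)
  obtain C where C: "C \<subseteq> compact_sets X" "\<forall>K\<in>compact_sets X. \<exists>L\<in>C. K \<subseteq> L"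
    "cof (compact_sets X) (\<subseteq>) = |C|"
    by (rule cofinal_compact_attaining_cof)
  obtain p where p: "continuous_map (top_of_set {0..1::real}) T p" "p 1 = \<one>\<^bsub>G\<^esub>"
    "\<And>t. t \<in> {0..<1} \<Longrightarrow> \<exists>U. openin T U \<and> \<one>\<^bsub>G\<^esub> \<in> U \<and> p t \<notin> U"
    using arc_ending_at_one[OF \<open>contains_arc T\<close>] by metis
  obtain U where U: "openin T U" "\<one>\<^bsub>G\<^esub> \<in> U" "p 0 \<notin> U"
    using p(3)[of 0] by auto
  let ?N = "(\<lambda>(K, U). maps_into X T K U) ` (C \<times> \<B>)"
  have "|\<V>| \<le>o |?N|"
    using local_base_maps_into[OF \<B>(1) one C(1,2)] \<V>(2)
    by (metis char mem_Collect_eq min_card_le)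
  also have "|?N| \<le>o |C \<times> \<B>|"
    by (rule card_of_image)
  also have "|C \<times> \<B>| =o |C| *c |\<B>|"
    by (simp add: cprod_def Field_card_of card_of_refl)
  finally have upper: "|\<V>| \<le>o |C| *c |\<B>|" .
  have \<B>\<V>: "|\<B>| \<le>o |\<V>|"
    using character_le_const[OF assms(1) one \<V>(1)] \<B>(2) by (simp add: character_def)
  have "|C| \<le>o |\<V>|"
    using cof_compact_le[OF assms(2,3) p(1,2) U \<V>(1)] C(3) by simp
  moreover have "Cinfinite |\<V>|"
    using local_base_infinite[OF p \<B>(1)] \<B>\<V>
    by (metis card_of_Card_order card_of_ordLeq_infinite cinfinite_def Field_card_of)
  ultimately have "|C| *c |\<B>| \<le>o |\<V>|"
    using \<B>\<V> by (intro cprod_cinfinite_bound) (auto simp: card_of_Card_order)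
  then show ?thesis
    using upper \<V>(2) \<B>(2) C(3) by (simp add: ordIso_iff_ordLeq)
qed

end
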